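(* For each $n\ge1$ let $X_{n,1},\ldots,X_{n,k_n}$ be bounded self-adjoint free random variables in a noncommutative probability space $(\mathcal{A},E)$ with $E(X_{n,i})=0$ and $\|X_{n,i}\|\le L_{n,i}$. Let $\mu_{n,i}$ be the spectral measure of $X_{n,i}$, $G_{n,i}(z)=\int\frac{\mu_{n,i}(dt)}{z-t}$ its Cauchy transform, $g_{n,i}(z)=G_{n,i}(1/z)$, $v_n=\sum_{i}E(X_{n,i}^2)$, $S_n=\sum_i X_{n,i}$ and $\mu_n$ the spectral measure of $S_n$. Let $R_{n,i}$, $m_{n,i}$ be numbers such that (1) $R_{n,i}\ge L_{n,i}$; (2) $|G_{n,i}(z)|\ge m_{n,i}>0$ for all $z$ with $|z|=R_{n,i}$; (3) $g_{n,i}$ has exactly one zero in $|z|<R_{n,i}^{-1}$. Put $m_n=\min_i m_{n,i}$ and $D_n=\sum_{i=1}^{k_n}R_{n,i}m_{n,i}^{-2}$. Suppose that (i) $\liminf_{n\to\infty} m_n\sqrt{v_n}>4$ and (ii) $\limsup_{n\to\infty}D_n/v_n^{3/2}\le 1/8$. Then for all sufficiently large $n$, the support of $\mu_n$ is contained in \[\bigl(-2\sqrt{v_n}-cD_n/v_n,\;2\sqrt{v_n}+cD_n/v_n\bigr),\] where $c>0$ is an absolute constant (e.g., $c=5$).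
   Context: A noncommutative probability space is a pair $(\mathcal{A},E)$ where $\mathcal{A}$ is a unital $C^*$-algebra of bounded operators on a complex separable Hilbert space and $E$ is a faithful, tracial, norm-continuous state on $\mathcal{A}$. For self-adjoint $A$ with spectral resolution $P(d\lambda)$, its spectral probability measure is $\mu(d\lambda)=E(P(d\lambda))$. Variables $A_1,\ldots,A_n$ are free if, with $\mathcal{A}_i$ the $C^*$-algebra generated by $A_i$ and $I$, $E(\overline{A}_{i(1)}\cdots\overline{A}_{i(m)})=0$ whenever $\overline{A}_{i(s)}\in\mathcal{A}_{i(s)}$, $E(\overline{A}_{i(s)})=0$ and $i(s+1)\neq i(s)$ for all $s$. *)

theory Defs
  imports "HOL-Analysis.Analysis" "HOL-Probability.Probability"
begin

class cstar_algebra = real_normed_algebra_1 + banach +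
  fixes scaleC :: "complex \<Rightarrow> 'a \<Rightarrow> 'a"
    and cstar :: "'a \<Rightarrow> 'a"
  assumes scaleC_of_real: "scaleC (complex_of_real r) x = scaleR r x"
    and scaleC_add_left: "scaleC (a + b) x = scaleC a x + scaleC b x"
    and scaleC_add_right: "scaleC a (x + y) = scaleC a x + scaleC a y"
    and scaleC_scaleC: "scaleC a (scaleC b x) = scaleC (a * b) x"
    and norm_scaleC: "norm (scaleC a x) = cmod a * norm x"
    and mult_scaleC_left: "scaleC a x * y = scaleC a (x * y)"
    and mult_scaleC_right: "x * scaleC a y = scaleC a (x * y)"
    and cstar_add: "cstar (x + y) = cstar x + cstar y"
    and cstar_scaleC: "cstar (scaleC a x) = scaleC (cnj a) (cstar x)"
    and cstar_mult: "cstar (x * y) = cstar y * cstar x"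
    and cstar_cstar: "cstar (cstar x) = x"
    and cstar_identity: "norm (cstar x * x) = norm x ^ 2"

definition nc_prob_state :: "('a::cstar_algebra \<Rightarrow> complex) \<Rightarrow> bool" where
  "nc_prob_state E \<longleftrightarrow>
     (\<forall>x y. E (x + y) = E x + E y) \<and>
     (\<forall>a x. E (scaleC a x) = a * E x) \<and>
     E 1 = 1 \<and>
     (\<forall>x. E (cstar x * x) \<in> \<real> \<and> Re (E (cstar x * x)) \<ge> 0) \<and>
     (\<forall>x. E (cstar x * x) = 0 \<longrightarrow> x = 0) \<and>
     (\<forall>x y. E (x * y) = E (y * x)) \<and>
     continuous_on UNIV E"

definition self_adjoint :: "'a::cstar_algebra \<Rightarrow> bool" where
  "self_adjoint x \<longleftrightarrow> cstar x = x"

text \<open>C*-algebra generated by x and the unit (for self-adjoint x): norm closure of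
complex polynomials in x.\<close>
definition cstar_gen :: "'a::cstar_algebra \<Rightarrow> 'a set" where
  "cstar_gen x = closure {(\<Sum>j<N. scaleC (c j) (x ^ j)) | N c. True}"

definition free_family :: "('a::cstar_algebra \<Rightarrow> complex) \<Rightarrow> 'i set \<Rightarrow> ('i \<Rightarrow> 'a) \<Rightarrow> bool" where
  "free_family E I Y \<longleftrightarrow>
     (\<forall>(m::nat) (\<iota>::nat \<Rightarrow> 'i) (a::nat \<Rightarrow> 'a).
        m \<ge> 1 \<and>
        (\<forall>s<m. \<iota> s \<in> I \<and> a s \<in> cstar_gen (Y (\<iota> s)) \<and> E (a s) = 0) \<and>
        (\<forall>s. s + 1 < m \<longrightarrow> \<iota> (s + 1) \<noteq> \<iota> s)
        \<longrightarrow> E (prod_list (map a [0..<m])) = 0)"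

definition spectral_measure :: "('a::cstar_algebra \<Rightarrow> complex) \<Rightarrow> 'a \<Rightarrow> real measure \<Rightarrow> bool" where
  "spectral_measure E A \<mu> \<longleftrightarrow>
     self_adjoint A \<and> prob_space \<mu> \<and> sets \<mu> = sets borel \<and>
     emeasure \<mu> (- {- norm A .. norm A}) = 0 \<and>
     (\<forall>k::nat. complex_of_real (\<integral>t. t ^ k \<partial>\<mu>) = E (A ^ k))"

definition cauchy_transform :: "real measure \<Rightarrow> complex \<Rightarrow> complex" where
  "cauchy_transform \<mu> z = (\<integral>t. 1 / (z - complex_of_real t) \<partial>\<mu>)"

text \<open>g(z) = G(1/z), extended by its limit value 0 at z = 0.\<close>
definition inv_cauchy_transform :: "real measure \<Rightarrow> complex \<Rightarrow> complex" where
  "inv_cauchy_transform \<mu> z = (if z = 0 then 0 else cauchy_transform \<mu> (1 / z))"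

definition measure_support :: "real measure \<Rightarrow> real set" where
  "measure_support \<mu> = {x. \<forall>e>0. emeasure \<mu> {x - e <..< x + e} > 0}"

end

theory Submission
  imports Defs "HOL-Complex_Analysis.Complex_Analysis"
begin

text \<open>
  Write \<open>\<phi>\<^sub>i(w) = 1 + w h\<^sub>i(w)\<close> with \<open>h\<^sub>i\<close> the R-transform of the \<open>i\<close>-th summand. Freeness gives
  \<open>\<Phi> = 1 + \<Sum>\<^sub>i (\<phi>\<^sub>i - 1)\<close> for the sum \<open>S\<close>, and Lagrange inversion turns this into
  \<open>(n + 1) E(S\<^sup>n) = [w\<^sup>n] \<Phi>(w)\<^sup>n\<^sup>+\<^sup>1\<close>. Since \<open>1 / (1 - z t)\<close> has real part at least \<open>1/2\<close> for \<open>|z t| < 1\<close>,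
  Lagrange inversion and Cauchy's inequality bound the free cumulants of the \<open>i\<close>-th summand:
  \<open>|[w\<^sup>k\<^sup>+\<^sup>1] \<phi>\<^sub>i| \<le> 2\<^sup>k R\<^sub>i\<^sup>k\<^sup>+\<^sup>1 / k\<close>, where \<open>R\<^sub>i\<close> bounds its norm. As \<open>\<Phi>(w) = 1 + v w\<^sup>2 + \<dots>\<close>,
  the absolute coefficient sum of \<open>\<Phi>\<close> on \<open>|w| = 1 / \<surd>v\<close> is at most \<open>B = 2 + 4 v\<^sup>-\<^sup>3\<^sup>/\<^sup>2 \<Sum>\<^sub>i R\<^sub>i\<^sup>3\<close>, so the
  moments of \<open>S\<close> grow at most like \<open>(B \<surd>v)\<^sup>n\<close>, which confines the support. Finally
  \<open>m\<^sub>i \<le> |G\<^sub>i(\<i> R\<^sub>i)| \<le> 1 / R\<^sub>i\<close>, whence \<open>\<Sum>\<^sub>i R\<^sub>i\<^sup>3 \<le> D\<close>.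
\<close>

section \<open>Lagrange inversion and cumulant series\<close>

text \<open>Since \<open>b\<close> has no constant term, \<open>b ^ j\<close> starts at degree
  \<open>j\<close>, so coefficients of the composite are finite sums. A common bound
  \<open>N\<close> for all degrees lets the two sums be swapped.\<close>

lemma fps_nth_compose_mult:
  fixes a b c :: "'a::idom fps"
  assumes "fps_nth b 0 = 0" and "n \<le> N"
  shows "fps_nth (fps_compose a b * c) n = (\<Sum>j\<le>N. fps_nth a j * fps_nth (b ^ j * c) n)"
proof -
  have pre: "fps_nth (b ^ j) p = 0" if "p < j" for j p
    using startsby_zero_power_prefix[OF assms(1)] that by blast
  have comp: "fps_nth (fps_compose a b) p = (\<Sum>j\<le>N. fps_nth a j * fps_nth (b ^ j) p)" if "p \<le> n" for p
    unfolding fps_compose_nth using that assms(2) by (intro sum.mono_neutral_left) (auto simp: pre)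
  have "fps_nth (fps_compose a b * c) n =
      (\<Sum>p=0..n. \<Sum>j\<le>N. fps_nth a j * (fps_nth (b ^ j) p * fps_nth c (n - p)))"
    by (simp add: fps_mult_nth comp sum_distrib_right mult.assoc)
  also have "\<dots> = (\<Sum>j\<le>N. \<Sum>p=0..n. fps_nth a j * (fps_nth (b ^ j) p * fps_nth c (n - p)))"
    by (rule sum.swap)
  finally show ?thesis
    by (simp add: fps_mult_nth sum_distrib_left)
qed

lemma fps_deriv_inverse_power:
  fixes c :: "'a::field fps"
  assumes "fps_nth c 0 \<noteq> 0"
  shows "fps_deriv (inverse c ^ n) = - (of_nat n * fps_deriv c * inverse c ^ Suc n)"
proof (cases n)
  case (Suc l)
  then show ?thesis
    unfolding fps_deriv_power' fps_inverse_deriv[OF assms]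
    by (simp add: power2_eq_square mult.assoc del: of_nat_Suc)
qed simp

text \<open>The residue of \<open>g' g\<^sup>-\<^sup>(\<^sup>p\<^sup>+\<^sup>1\<^sup>)\<close> for \<open>g = z c(z)\<close>, stated without Laurent series.\<close>

lemma fps_nth_deriv_mult_inverse_power:
  fixes c :: "'a::field_char_0 fps"
  assumes c0: "fps_nth c 0 \<noteq> 0"
  shows "fps_nth (fps_deriv (fps_X * c) * inverse c ^ Suc p) p = (if p = 0 then 1 else 0)"
proof -
  have ic: "c * inverse c = 1"
    using inverse_mult_eq_1[OF c0] by (simp add: mult.commute)
  have "fps_deriv (fps_X * c) * inverse c ^ Suc p
      = (c * inverse c) * inverse c ^ p + fps_X * (fps_deriv c * inverse c ^ Suc p)"
    by (simp add: algebra_simps)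
  then have eq: "fps_deriv (fps_X * c) * inverse c ^ Suc p
      = inverse c ^ p + fps_X * (fps_deriv c * inverse c ^ Suc p)"
    by (simp add: ic)
  show ?thesis
  proof (cases p)
    case 0
    then show ?thesis unfolding eq by simp
  next
    case (Suc q)
    \<comment> \<open>Multiplying by \<open>p\<close> turns coefficient \<open>p\<close> into a
      coefficient of a derivative; characteristic 0 allows cancelling \<open>p\<close>
      afterwards.\<close>
    have "of_nat p * fps_nth (inverse c ^ p) p = fps_nth (fps_deriv (inverse c ^ p)) q"
      using Suc by (simp only: fps_deriv_nth Suc_eq_plus1)
    also have "\<dots> = - (of_nat p * fps_nth (fps_deriv c * inverse c ^ Suc p) q)"
      unfolding fps_deriv_inverse_power[OF c0]
      by (simp add: mult.assoc fps_of_nat[symmetric] del: of_nat_Suc power_Suc)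
    finally have "of_nat p * (fps_nth (inverse c ^ p) p + fps_nth (fps_deriv c * inverse c ^ Suc p) q) = 0"
      by (simp add: algebra_simps)
    moreover have "of_nat p \<noteq> (0::'a)" using Suc by (simp del: of_nat_Suc)
    ultimately have "fps_nth (inverse c ^ p) p + fps_nth (fps_deriv c * inverse c ^ Suc p) q = 0"
      by simp
    then show ?thesis unfolding eq using Suc by simp
  qed
qed

text \<open>Put \<open>g = fps_X * c\<close>. By the chain rule the derivative is a combination of
  terms \<open>g ^ j * fps_deriv g\<close>, and the residue lemma leaves only \<open>j = n\<close>.
  No inverse of \<open>g\<close> appears, so \<open>F\<close> can be chosen to have a known
  composite.\<close>

theorem fps_lagrange_inversion:
  fixes c F :: "'a::field_char_0 fps"
  assumes c0: "fps_nth c 0 \<noteq> 0"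
  shows "fps_nth (fps_deriv (fps_compose F (fps_X * c)) * inverse c ^ Suc n) n
    = of_nat (Suc n) * fps_nth F (Suc n)"
proof -
  have ic: "c * inverse c = 1"
    using inverse_mult_eq_1[OF c0] by (simp add: mult.commute)
  let ?g = "fps_X * c"
  have coeff: "fps_nth (?g ^ j * (fps_deriv ?g * inverse c ^ Suc n)) n = (if j = n then 1 else 0)"
    if "j \<le> n" for j
  proof -
    have "c ^ j * inverse c ^ Suc n = (c * inverse c) ^ j * inverse c ^ Suc (n - j)"
      using that by (simp add: power_mult_distrib flip: power_add mult.assoc)
    then have "c ^ j * inverse c ^ Suc n = inverse c ^ Suc (n - j)"
      by (simp only: ic power_one mult_1)
    then have "?g ^ j * (fps_deriv ?g * inverse c ^ Suc n)
        = fps_X ^ j * (fps_deriv ?g * inverse c ^ Suc (n - j))"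
      by (metis (no_types, lifting) mult.assoc mult.left_commute power_mult_distrib)
    then show ?thesis
      using that fps_nth_deriv_mult_inverse_power[OF c0, of "n - j"]
      by (simp only: fps_X_power_mult_nth) auto
  qed
  have "fps_nth (fps_deriv (fps_compose F ?g) * inverse c ^ Suc n) n
      = fps_nth (fps_compose (fps_deriv F) ?g * (fps_deriv ?g * inverse c ^ Suc n)) n"
    by (subst fps_compose_deriv) (simp_all only: mult.assoc, simp)
  also have "\<dots> = (\<Sum>j\<le>n. fps_nth (fps_deriv F) j * fps_nth (?g ^ j * (fps_deriv ?g * inverse c ^ Suc n)) n)"
    by (rule fps_nth_compose_mult) simp_all
  also have "\<dots> = (\<Sum>j\<le>n. if j = n then fps_nth (fps_deriv F) j else 0)"
    by (intro sum.cong refl) (simp only: atMost_iff coeff mult_1_right mult_zero_right if_distrib[of "(*) _"])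
  finally show ?thesis by (simp add: sum.delta del: power_Suc)
qed

text \<open>This is \<open>1 + w R(w)\<close> with \<open>R\<close> the R-transform of the moment series \<open>M\<close>; the functional
  inverse of the Cauchy transform is \<open>cumulant_series M / w\<close>.\<close>

definition cumulant_series :: "'a::field fps \<Rightarrow> 'a fps" where
  "cumulant_series M = fps_compose M (fps_inv (fps_X * M))"

text \<open>The functional inverse \<open>f\<close> of \<open>fps_X * M\<close> satisfies
  \<open>fps_X = f * cumulant_series M\<close>, hence \<open>f\<close> is
  \<open>fps_X * inverse (cumulant_series M)\<close>.\<close>

lemma cumulant_series_equations:
  fixes M :: "'a::field fps"
  assumes M0: "fps_nth M 0 = 1"
  shows "fps_nth (cumulant_series M) 0 = 1"
    and "fps_compose M (fps_X * inverse (cumulant_series M)) = cumulant_series M"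
    and "fps_compose (cumulant_series M) (fps_X * M) = M"
proof -
  let ?f = "fps_inv (fps_X * M)" and ?\<phi> = "cumulant_series M"
  show \<phi>0: "fps_nth ?\<phi> 0 = 1" by (simp add: cumulant_series_def M0)
  have g: "fps_nth (fps_X * M) 0 = 0" "fps_nth (fps_X * M) 1 \<noteq> 0" by (simp_all add: M0)
  have f0: "fps_nth ?f 0 = 0" by (simp add: fps_inv_def)
  have "fps_X = fps_compose (fps_X * M) ?f" using fps_inv_right[OF g] by simp
  also have "\<dots> = ?f * ?\<phi>"
    by (simp add: fps_compose_mult_distrib[OF f0] f0 cumulant_series_def)
  finally have "fps_X * inverse ?\<phi> = ?f * (?\<phi> * inverse ?\<phi>)" by (simp add: mult.assoc)
  also have "\<dots> = ?f" using inverse_mult_eq_1[of ?\<phi>] \<phi>0 by (simp add: mult.commute)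
  finally have f: "fps_X * inverse ?\<phi> = ?f" .
  show "fps_compose M (fps_X * inverse ?\<phi>) = ?\<phi>" unfolding f by (simp add: cumulant_series_def)
  show "fps_compose ?\<phi> (fps_X * M) = M"
    unfolding cumulant_series_def using fps_compose_assoc[OF g(1) f0, of M] fps_inv[OF g] by simp
qed

text \<open>Lagrange inversion with \<open>c = M\<close> and \<open>F = cumulant_series M\<close>,
  where \<open>fps_deriv M * inverse M ^ Suc n\<close> is \<open>- 1 / n\<close> times the
  derivative of \<open>inverse M ^ n\<close>. Bounding cumulants is thereby reduced to bounding
  powers of \<open>inverse M\<close>.\<close>

lemma fps_nth_cumulant_series:
  fixes M :: "'a::field_char_0 fps"
  assumes M0: "fps_nth M 0 = 1" and n: "n \<ge> 1"
  shows "fps_nth (cumulant_series M) (Suc n) = - (fps_nth (inverse M ^ n) (Suc n) / of_nat n)"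
proof -
  have nz: "fps_nth M 0 \<noteq> 0" using M0 by simp
  have "of_nat (Suc n) * fps_nth (inverse M ^ n) (Suc n) = fps_nth (fps_deriv (inverse M ^ n)) n"
    by simp
  also have "\<dots> = - (of_nat n * fps_nth (fps_deriv M * inverse M ^ Suc n) n)"
    unfolding fps_deriv_inverse_power[OF nz]
    by (simp add: mult.assoc fps_of_nat[symmetric] del: of_nat_Suc power_Suc)
  also have "fps_nth (fps_deriv M * inverse M ^ Suc n) n
      = of_nat (Suc n) * fps_nth (cumulant_series M) (Suc n)"
    using fps_lagrange_inversion[OF nz, of "cumulant_series M" n] cumulant_series_equations(3)[OF M0]
    by (simp del: of_nat_Suc power_Suc)
  finally have "of_nat (Suc n) * (fps_nth (inverse M ^ n) (Suc n)
      + of_nat n * fps_nth (cumulant_series M) (Suc n)) = 0"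
    by (simp add: algebra_simps del: power_Suc)
  then have "fps_nth (inverse M ^ n) (Suc n) + of_nat n * fps_nth (cumulant_series M) (Suc n) = 0"
    by (simp del: of_nat_Suc power_Suc)
  then show ?thesis using n by (simp add: field_simps add_eq_0_iff)
qed

text \<open>The first two free cumulants are mean and variance: Lagrange inversion at
  \<open>n = 0\<close> and \<open>n = 1\<close>.\<close>

lemma cumulant_series_centered:
  fixes M :: "'a::field_char_0 fps"
  assumes M0: "fps_nth M 0 = 1" and M1: "fps_nth M 1 = 0"
  shows "fps_nth (cumulant_series M) 1 = 0" and "fps_nth (cumulant_series M) 2 = fps_nth M 2"
proof -
  have nz: "fps_nth M 0 \<noteq> 0" using M0 by simp
  have L: "of_nat (Suc n) * fps_nth (cumulant_series M) (Suc n) = fps_nth (fps_deriv M * inverse M ^ Suc n) n" for n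
    using fps_lagrange_inversion[OF nz, of "cumulant_series M" n] cumulant_series_equations(3)[OF M0]
    by (simp del: of_nat_Suc power_Suc)
  show "fps_nth (cumulant_series M) 1 = 0" using L[of 0] M1 by simp
  have "2 * fps_nth (cumulant_series M) 2 = 2 * fps_nth M 2 "
    using L[of 1] M0 M1 by (simp add: fps_mult_nth_1 numeral_2_eq_2 fps_power_zeroth)
  then show "fps_nth (cumulant_series M) 2 = fps_nth M 2" by simp
qed

text \<open>The way back from cumulants to moments: Lagrange inversion with
  \<open>c = inverse \<phi>\<close> and \<open>F = fps_X * M\<close>, whose composite is
  \<open>fps_X\<close>.\<close>

lemma fps_nth_power_of_cumulant_series:
  fixes M \<phi> :: "'a::field_char_0 fps"
  assumes \<phi>0: "fps_nth \<phi> 0 = 1" and M: "fps_compose M (fps_X * inverse \<phi>) = \<phi>"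
  shows "fps_nth (\<phi> ^ Suc n) n = of_nat (Suc n) * fps_nth M n"
proof -
  have "fps_compose (fps_X * M) (fps_X * inverse \<phi>) = fps_X * (inverse \<phi> * \<phi>)"
    by (simp add: fps_compose_mult_distrib M mult.assoc)
  also have "inverse \<phi> * \<phi> = 1" using \<phi>0 by (intro inverse_mult_eq_1) simp
  finally have "fps_compose (fps_X * M) (fps_X * inverse \<phi>) = fps_X" by simp
  then show ?thesis
    using fps_lagrange_inversion[of "inverse \<phi>" "fps_X * M" n] \<phi>0 by (simp del: power_Suc of_nat_Suc)
qed

text \<open>The weighted absolute coefficient sum is submultiplicative under the Cauchy product.
  Working with partial sums avoids all convergence questions.\<close>

lemma fps_power_majorant:
  fixes a :: "'a::{real_normed_div_algebra,comm_ring_1} fps"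
  assumes \<rho>: "\<rho> \<ge> 0" and B: "\<And>N. (\<Sum>j\<le>N. norm (fps_nth a j) * \<rho> ^ j) \<le> B"
  shows "(\<Sum>j\<le>N. norm (fps_nth (a ^ n) j) * \<rho> ^ j) \<le> B ^ n"
proof (induction n arbitrary: N)
  case 0
  have "(\<Sum>j\<le>N. norm (fps_nth (1 :: 'a fps) j) * \<rho> ^ j) = (\<Sum>j\<in>{0}. norm (fps_nth (1 :: 'a fps) j) * \<rho> ^ j)"
    by (intro sum.mono_neutral_right) auto
  then show ?case by simp
next
  case (Suc n)
  let ?u = "\<lambda>j. norm (fps_nth a j) * \<rho> ^ j" and ?v = "\<lambda>j. norm (fps_nth (a ^ n) j) * \<rho> ^ j"
  have u: "?u j \<ge> 0" and v: "?v j \<ge> 0" for j using \<rho> by simp_all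
  have "(\<Sum>j\<le>N. norm (fps_nth (a ^ Suc n) j) * \<rho> ^ j) \<le> (\<Sum>j\<le>N. \<Sum>i\<le>j. ?u i * ?v (j - i))"
  proof (rule sum_mono)
    fix j assume "j \<in> {..N}"
    have "norm (fps_nth (a ^ Suc n) j) \<le> (\<Sum>i\<le>j. norm (fps_nth a i * fps_nth (a ^ n) (j - i)))"
      by (simp add: fps_mult_nth atLeast0AtMost norm_sum)
    then have "norm (fps_nth (a ^ Suc n) j) * \<rho> ^ j
        \<le> (\<Sum>i\<le>j. norm (fps_nth a i) * norm (fps_nth (a ^ n) (j - i))) * \<rho> ^ j"
      using \<rho> by (intro mult_right_mono) (simp_all add: norm_mult)
    also have "\<dots> = (\<Sum>i\<le>j. ?u i * ?v (j - i))"
      unfolding sum_distrib_right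
    proof (rule sum.cong)
      fix i assume "i \<in> {..j}"
      then have "\<rho> ^ j = \<rho> ^ i * \<rho> ^ (j - i)" by (simp flip: power_add)
      then show "norm (fps_nth a i) * norm (fps_nth (a ^ n) (j - i)) * \<rho> ^ j = ?u i * ?v (j - i)"
        by simp
    qed simp
    finally show "norm (fps_nth (a ^ Suc n) j) * \<rho> ^ j \<le> (\<Sum>i\<le>j. ?u i * ?v (j - i))" .
  qed
  also have "\<dots> = (\<Sum>(i,j)\<in>{(i,j). i + j \<le> N}. ?u i * ?v j)"
    by (rule sum.triangle_reindex_eq[symmetric])
  \<comment> \<open>The triangle is enlarged to a square, over which the sum factors.\<close>
  also have "\<dots> \<le> (\<Sum>(i,j)\<in>{..N} \<times> {..N}. ?u i * ?v j)"
    by (rule sum_mono2) (auto intro!: mult_nonneg_nonneg u v simp: \<rho>)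
  also have "\<dots> = (\<Sum>i\<le>N. ?u i) * (\<Sum>j\<le>N. ?v j)"
    by (simp add: sum_product sum.cartesian_product)
  also have "\<dots> \<le> B * B ^ n"
    using B[of N] Suc.IH[of N] u v order_trans[OF sum_nonneg[of "{..N}" ?u] B]
    by (intro mult_mono) (auto intro!: sum_nonneg simp: \<rho>)
  finally show ?case by simp
qed

section \<open>Additivity of free cumulants\<close>

lemma scaleC_zero_left: "scaleC 0 (x::'a::cstar_algebra) = 0"
  using scaleC_of_real[of 0 x] by simp

lemma scaleC_one: "scaleC 1 (x::'a::cstar_algebra) = x"
  using scaleC_of_real[of 1 x] by simp

lemma scaleC_minus_left: "scaleC (- a) (x::'a::cstar_algebra) = - scaleC a x"
  using scaleC_add_left[of a "- a" x] by (simp add: scaleC_zero_left eq_neg_iff_add_eq_0 add.commute)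

lemma scaleC_sum_left: "scaleC (\<Sum>i\<in>A. f i) (x::'a::cstar_algebra) = (\<Sum>i\<in>A. scaleC (f i) x)"
  by (induction A rule: infinite_finite_induct) (simp_all add: scaleC_zero_left scaleC_add_left)

lemma scaleC_zero_right: "scaleC a (0::'a::cstar_algebra) = 0"
  using scaleC_add_right[of a 0 "0::'a"] by simp

lemma scaleC_sum_right: "scaleC a (\<Sum>i\<in>A. f i :: 'a::cstar_algebra) = (\<Sum>i\<in>A. scaleC a (f i))"
  by (induction A rule: infinite_finite_induct) (simp_all add: scaleC_zero_right scaleC_add_right)

lemma cstar_gen_polynomial: "(\<Sum>j<N. scaleC (c j) (x ^ j)) \<in> cstar_gen (x::'a::cstar_algebra)"
  unfolding cstar_gen_def by (rule subsetD[OF closure_subset]) blast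

context
  fixes E :: "'a::cstar_algebra \<Rightarrow> complex"
  assumes E: "nc_prob_state E"
begin

lemma state_add: "E (x + y) = E x + E y"
  and state_scaleC: "E (scaleC a x) = a * E x"
  and state_one: "E 1 = 1"
  using E by (auto simp: nc_prob_state_def)

lemma state_zero: "E 0 = 0"
  using state_add[of 0 0] by simp

lemma state_minus: "E (- x) = - E x"
  using state_add[of x "- x"] by (simp add: state_zero eq_neg_iff_add_eq_0 add.commute)

lemma state_sum: "E (\<Sum>i\<in>A. f i) = (\<Sum>i\<in>A. E (f i))"
  by (induction A rule: infinite_finite_induct) (simp_all add: state_zero state_add)

end

section \<open>Formal resolvents, alternating words and additivity\<close>

definition moment_series :: "('a::cstar_algebra \<Rightarrow> complex) \<Rightarrow> 'a \<Rightarrow> complex fps" where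
  "moment_series E x = Abs_fps (\<lambda>n. E (x ^ n))"

definition scalar_fps :: "complex fps \<Rightarrow> 'a::cstar_algebra fps" where
  "scalar_fps \<phi> = Abs_fps (\<lambda>n. scaleC (fps_nth \<phi> n) 1)"

text \<open>\<open>\<phi>(s) - s x\<close> and its inverse \<open>\<Sum>\<^sub>j \<phi>(s)\<^sup>-\<^sup>1 (s / \<phi>(s))\<^sup>j x\<^sup>j\<close>, as series in \<open>s\<close> over the algebra.
  If \<open>G(K(s)) = s\<close> and \<open>\<phi>(s) = s K(s)\<close>, the inverse is \<open>s\<^sup>-\<^sup>1 (K(s) - x)\<^sup>-\<^sup>1\<close>.\<close>

definition pencil :: "complex fps \<Rightarrow> 'a::cstar_algebra \<Rightarrow> 'a fps" where
  "pencil \<phi> x = scalar_fps \<phi> - fps_X * fps_const x"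

definition resolvent_series :: "complex fps \<Rightarrow> 'a::cstar_algebra \<Rightarrow> 'a fps" where
  "resolvent_series \<phi> x =
     Abs_fps (\<lambda>n. \<Sum>j\<le>n. scaleC (fps_nth ((fps_X * inverse \<phi>) ^ j * inverse \<phi>) n) (x ^ j))"

lemma scalar_fps_commute: "scalar_fps \<phi> * A = A * (scalar_fps \<phi> :: 'a::cstar_algebra fps)"
proof (rule fps_ext)
  fix n
  have "fps_nth (scalar_fps \<phi> * A) n = (\<Sum>i=0..n. scaleC (fps_nth \<phi> i) (fps_nth A (n - i)))"
    by (simp add: scalar_fps_def fps_mult_nth mult_scaleC_left)
  also have "\<dots> = (\<Sum>i=0..n. scaleC (fps_nth \<phi> (n - i)) (fps_nth A i))"
    by (subst sum.atLeastAtMost_rev) (auto intro!: sum.cong)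
  also have "\<dots> = fps_nth (A * scalar_fps \<phi>) n"
    by (simp add: scalar_fps_def fps_mult_nth mult_scaleC_right)
  finally show "fps_nth (scalar_fps \<phi> * A) n = fps_nth (A * scalar_fps \<phi>) n" .
qed

text \<open>The \<open>j\<close>-th term is divisible by \<open>fps_X ^ j\<close>, so the truncation
  in the definition loses nothing and a larger common bound gives the same value.\<close>

lemma fps_nth_resolvent_series:
  assumes "n \<le> N"
  shows "fps_nth (resolvent_series \<phi> x) n =
    (\<Sum>j\<le>N. scaleC (fps_nth ((fps_X * inverse \<phi>) ^ j * inverse \<phi>) n) (x ^ j))"
proof -
  have "fps_nth ((fps_X * inverse \<phi>) ^ j * inverse \<phi>) n = 0" if "n < j" for j
    using that by (simp add: power_mult_distrib mult.assoc fps_X_power_mult_nth)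
  then show ?thesis unfolding resolvent_series_def fps_nth_Abs_fps
    using assms by (intro sum.mono_neutral_left) (auto simp: scaleC_zero_left)
qed

text \<open>A telescoping geometric series: \<open>scalar_fps \<phi>\<close> cancels the factor
  \<open>inverse \<phi>\<close>, while \<open>fps_X * fps_const x\<close> raises \<open>j\<close> by
  one, so only the term \<open>j = 0\<close> remains.\<close>

lemma resolvent_series_pencil:
  fixes x :: "'a::cstar_algebra"
  assumes \<phi>0: "fps_nth \<phi> 0 \<noteq> 0"
  shows "resolvent_series \<phi> x * pencil \<phi> x = 1"
proof (rule fps_ext)
  fix n
  let ?V = "resolvent_series \<phi> x" and ?f = "fps_X * inverse \<phi>"
  let ?g = "\<lambda>j. ?f ^ j * inverse \<phi>"
  have i\<phi>: "inverse \<phi> * \<phi> = 1" using \<phi>0 by (rule inverse_mult_eq_1)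
  have "fps_nth (?V * scalar_fps \<phi>) n =
      (\<Sum>p=0..n. \<Sum>j\<le>n. scaleC (fps_nth (?g j) p * fps_nth \<phi> (n - p)) (x ^ j))"
    by (subst fps_mult_nth, intro sum.cong) (auto simp: fps_nth_resolvent_series[where N = n] scalar_fps_def
        mult_scaleC_right scaleC_sum_right scaleC_scaleC mult.commute)
  also have "\<dots> = (\<Sum>j\<le>n. \<Sum>p=0..n. scaleC (fps_nth (?g j) p * fps_nth \<phi> (n - p)) (x ^ j))"
    by (rule sum.swap)
  also have "\<dots> = (\<Sum>j\<le>n. scaleC (fps_nth (?g j * \<phi>) n) (x ^ j))"
    by (simp add: fps_mult_nth scaleC_sum_left)
  also have "\<dots> = (\<Sum>j\<le>n. scaleC (fps_nth (?f ^ j) n) (x ^ j))"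
    by (simp only: mult.assoc i\<phi> mult_1_right)
  also have "\<dots> = scaleC (fps_nth 1 n) 1 + (\<Sum>j<n. scaleC (fps_nth (?f ^ Suc j) n) (x ^ Suc j))"
    by (simp only: lessThan_Suc_atMost[symmetric] sum.lessThan_Suc_shift power_0)
  finally have 1: "fps_nth (?V * scalar_fps \<phi>) n = \<dots>" .
  have 2: "fps_nth (?V * (fps_X * fps_const x)) n = (\<Sum>j<n. scaleC (fps_nth (?f ^ Suc j) n) (x ^ Suc j))"
  proof (cases n)
    case 0
    then show ?thesis by (simp add: fps_mult_nth)
  next
    case (Suc q)
    have "fps_nth (?V * (fps_X * fps_const x)) n = fps_nth (fps_X * (?V * fps_const x)) n"
      by (metis fps_mult_fps_X_commute mult.assoc)
    also have "\<dots> = fps_nth ?V q * x" using Suc by (simp del: fps_mult_fps_X_commute)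
    also have "\<dots> = (\<Sum>j\<le>q. scaleC (fps_nth (?g j) q) (x ^ Suc j))"
      by (simp add: fps_nth_resolvent_series[of q q] sum_distrib_right mult_scaleC_left power_commutes)
    also have "\<dots> = (\<Sum>j<n. scaleC (fps_nth (?f ^ Suc j) n) (x ^ Suc j))"
    proof (rule sum.cong)
      fix j
      have "?f ^ Suc j = fps_X * ?g j" by (simp add: algebra_simps)
      then show "scaleC (fps_nth (?g j) q) (x ^ Suc j) = scaleC (fps_nth (?f ^ Suc j) n) (x ^ Suc j)"
        using Suc by (simp del: power_Suc)
    qed (use Suc in auto)
    finally show ?thesis .
  qed
  show "fps_nth (?V * pencil \<phi> x) n = fps_nth 1 n"
    unfolding pencil_def right_diff_distrib fps_sub_nth 1 2
    by (simp add: scaleC_one scaleC_zero_left)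
qed

text \<open>In a noncommutative algebra the other side needs an argument: the coefficients of the
  resolvent are polynomials in \<open>x\<close> and so commute with the pencil.\<close>

lemma pencil_resolvent_series:
  fixes x :: "'a::cstar_algebra"
  assumes \<phi>0: "fps_nth \<phi> 0 \<noteq> 0"
  shows "pencil \<phi> x * resolvent_series \<phi> x = 1"
proof -
  let ?V = "resolvent_series \<phi> x"
  have x: "fps_const x * ?V = ?V * fps_const x"
    by (rule fps_ext) (simp add: resolvent_series_def sum_distrib_left sum_distrib_right
        mult_scaleC_left mult_scaleC_right power_commutes)
  have "fps_X * fps_const x * ?V = fps_X * (?V * fps_const x)"
    by (simp only: mult.assoc x)
  also have "\<dots> = ?V * (fps_X * fps_const x)"
    by (metis fps_mult_fps_X_commute mult.assoc)
  finally have "pencil \<phi> x * ?V = ?V * pencil \<phi> x"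
    by (simp only: pencil_def left_diff_distrib right_diff_distrib scalar_fps_commute)
  then show ?thesis using resolvent_series_pencil[OF \<phi>0] by simp
qed

text \<open>The state replaces each \<open>x ^ j\<close> by a moment. If \<phi> is the cumulant
  series of \<open>x\<close>, the right side is the coefficient of the series 1, so all higher
  coefficients of the resolvent are centered.\<close>

lemma state_resolvent_series:
  assumes E: "nc_prob_state E"
  shows "E (fps_nth (resolvent_series \<phi> x) n) =
    fps_nth (fps_compose (moment_series E x) (fps_X * inverse \<phi>) * inverse \<phi>) n"
proof -
  have "E (fps_nth (resolvent_series \<phi> x) n) =
      (\<Sum>j\<le>n. E (x ^ j) * fps_nth ((fps_X * inverse \<phi>) ^ j * inverse \<phi>) n)"
    by (simp add: resolvent_series_def state_sum[OF E] state_scaleC[OF E] mult.commute)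
  then show ?thesis
    by (subst fps_nth_compose_mult[where N = n]) (simp_all add: moment_series_def)
qed

text \<open>Additive closure of the words whose neighbouring letters carry different indices;
  \<open>i\<close> is the index of the first letter. Signs are carried by the letters, so closure
  under sums suffices.\<close>

inductive alternating :: "('i \<Rightarrow> 'a::ring_1 set) \<Rightarrow> 'i \<Rightarrow> 'a \<Rightarrow> bool" for C where
  letter: "a \<in> C i \<Longrightarrow> alternating C i a"
| word: "a \<in> C i \<Longrightarrow> alternating C j y \<Longrightarrow> i \<noteq> j \<Longrightarrow> alternating C i (a * y)"
| zero: "alternating C i 0"
| add: "alternating C i x \<Longrightarrow> alternating C i y \<Longrightarrow> alternating C i (x + y)"

lemma alternating_sum:
  assumes "\<And>a. a \<in> A \<Longrightarrow> alternating C i (f a)"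
  shows "alternating C i (\<Sum>a\<in>A. f a)"
  using assms by (induction A rule: infinite_finite_induct) (auto intro: alternating.intros)


lemma state_alternating:
  assumes E: "nc_prob_state E" and free: "free_family E I Y"
    and C: "\<And>i. C i \<subseteq> {a. i \<in> I \<and> a \<in> cstar_gen (Y i) \<and> E a = 0}"
    and y: "alternating C i y"
  shows "E y = 0"
proof -
  \<comment> \<open>Indices are stored with the letters because an element, such as 0, may lie in
    several \<open>C i\<close>.\<close>
  define ok where "ok ps \<longleftrightarrow> successively (\<lambda>p q. fst p \<noteq> fst q) ps \<and> (\<forall>p\<in>set ps. snd p \<in> C (fst p))" for ps
  have word: "E (prod_list (map snd ps)) = 0" if "ok ps" "ps \<noteq> []" for ps
  proof -
    have mem: "snd (ps ! s) \<in> {a. fst (ps ! s) \<in> I \<and> a \<in> cstar_gen (Y (fst (ps ! s))) \<and> E a = 0}"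
      if "s < length ps" for s
    proof -
      have "snd (ps ! s) \<in> C (fst (ps ! s))" using \<open>ok ps\<close> nth_mem[OF that] by (simp add: ok_def)
      then show ?thesis by (rule subsetD[OF C])
    qed
    have adj: "fst (ps ! s) \<noteq> fst (ps ! Suc s)" if "Suc s < length ps" for s
      using \<open>ok ps\<close> that by (simp add: ok_def successively_conv_nth)
    have neq: "fst (ps ! (s + 1)) \<noteq> fst (ps ! s)" if "s + 1 < length ps" for s
      using adj[of s, symmetric] that by simp
    have "1 \<le> length ps" using that(2) by (cases ps) auto
    then have "E (prod_list (map (\<lambda>s. snd (ps ! s)) [0..<length ps])) = 0"
      using mem neq by (intro free[unfolded free_family_def, THEN spec[of _ "length ps"],
          THEN spec[of _ "\<lambda>s. fst (ps ! s)"], THEN spec[of _ "\<lambda>s. snd (ps ! s)"], THEN mp] conjI allI impI) blast+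
    also have "map (\<lambda>s. snd (ps ! s)) [0..<length ps] = map snd ps"
      by (rule nth_equalityI) simp_all
    finally show ?thesis .
  qed
  \<comment> \<open>Generalised over a left factor: the case \<open>word\<close> moves the first
    letter of the word to the end of \<open>ps\<close>, and the empty prefix gives the
    claim.\<close>
  have "\<forall>ps. ok ps \<longrightarrow> (ps \<noteq> [] \<longrightarrow> fst (last ps) \<noteq> i) \<longrightarrow> E (prod_list (map snd ps) * y) = 0"
    using y
  proof induction
    case (letter a i)
    show ?case
    proof (intro allI impI)
      fix ps assume "ok ps" "ps \<noteq> [] \<longrightarrow> fst (last ps) \<noteq> i"
      then have "ok (ps @ [(i, a)])"
        using letter by (auto simp: ok_def successively_append_iff)
      from word[OF this] show "E (prod_list (map snd ps) * a) = 0" by simp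
    qed
  next
    case (word a i j y)
    show ?case
    proof (intro allI impI)
      fix ps assume "ok ps" "ps \<noteq> [] \<longrightarrow> fst (last ps) \<noteq> i"
      then have "ok (ps @ [(i, a)])"
        using word by (auto simp: ok_def successively_append_iff)
      then show "E (prod_list (map snd ps) * (a * y)) = 0"
        using word.IH word.hyps by (auto simp: mult.assoc dest!: spec[of _ "ps @ [(i, a)]"])
    qed
  next
    case (zero i)
    then show ?case by (simp add: state_zero[OF E])
  next
    case (add i x y)
    then show ?case by (simp add: distrib_left state_add[OF E])
  qed
  from this[rule_format, of "[]"] show ?thesis by (simp add: ok_def)
qed

text \<open>With \<open>e\<^sub>i = 1 - (\<phi>\<^sub>i - s Y\<^sub>i)\<^sup>-\<^sup>1\<close>, which is centered and in the algebra of \<open>Y\<^sub>i\<close>, the inverse of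
  \<open>\<Phi> - s \<Sum>\<^sub>i Y\<^sub>i\<close> is the signed sum of all alternating words in the \<open>e\<^sub>i\<close>. By freeness its expectation
  is that of the empty word.\<close>

theorem free_cumulant_additivity:
  fixes Y :: "'i \<Rightarrow> 'a::cstar_algebra"
  assumes E: "nc_prob_state E" and I: "finite I" and free: "free_family E I Y"
    and \<phi>0: "\<And>i. i \<in> I \<Longrightarrow> fps_nth (\<phi> i) 0 = 1"
    and \<phi>: "\<And>i. i \<in> I \<Longrightarrow> fps_compose (moment_series E (Y i)) (fps_X * inverse (\<phi> i)) = \<phi> i"
  defines "\<Phi> \<equiv> 1 + (\<Sum>i\<in>I. \<phi> i - 1)"
  shows "fps_compose (moment_series E (\<Sum>i\<in>I. Y i)) (fps_X * inverse \<Phi>) = \<Phi>"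
proof -
  have \<Phi>0: "fps_nth \<Phi> 0 = 1" by (simp add: \<Phi>_def fps_sum_nth \<phi>0)
  define U where "U i = pencil (\<phi> i) (Y i)" for i
  define V where "V i = resolvent_series (\<phi> i) (Y i)" for i
  define e where "e i = 1 - V i" for i
  define W where "W = resolvent_series \<Phi> (\<Sum>i\<in>I. Y i)"
  \<comment> \<open>\<open>w i\<close> will turn out to be the part of \<open>W\<close> made of the
    words beginning with index \<open>i\<close>.\<close>
  define w where "w i = - ((U i - 1) * W)" for i
  define C where "C i = {a. i \<in> I \<and> a \<in> cstar_gen (Y i) \<and> E a = 0}" for i
  have VU: "V i * U i = 1" if "i \<in> I" for i
    unfolding U_def V_def using \<phi>0[OF that] by (intro resolvent_series_pencil) simp
  have inv\<phi>: "\<phi> i * inverse (\<phi> i) = 1" if "i \<in> I" for i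
    using inverse_mult_eq_1[of "\<phi> i"] \<phi>0[OF that] by (simp add: mult.commute)
  have EV: "E (fps_nth (V i) n) = fps_nth 1 n" if "i \<in> I" for i n
    unfolding V_def state_resolvent_series[OF E] \<phi>[OF that] inv\<phi>[OF that] ..
  have e0: "fps_nth (e i) 0 = 0" if "i \<in> I" for i
    using \<phi>0[OF that] by (simp add: e_def V_def resolvent_series_def scaleC_one)
  \<comment> \<open>The letters of the recursion for \<open>w\<close> are the coefficients of
    \<open>- e i\<close>, hence the sign. The unit series is written as a constant polynomial in
    \<open>Y i\<close>.\<close>
  have e_C: "- fps_nth (e i) n \<in> C i" if "i \<in> I" for i n
  proof -
    have "- fps_nth (e i) n = (\<Sum>j<Suc n. scaleC (fps_nth ((fps_X * inverse (\<phi> i)) ^ j * inverse (\<phi> i)) n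
        - (if j = 0 then fps_nth 1 n else 0)) (Y i ^ j))" (is "_ = ?s")
    proof -
      have 1: "fps_nth (1 :: 'a fps) n = (\<Sum>j<Suc n. scaleC (if j = 0 then fps_nth 1 n else 0) (Y i ^ j))"
        by (simp only: sum.lessThan_Suc_shift) (simp add: scaleC_zero_left scaleC_one)
      have "- fps_nth (e i) n = fps_nth (V i) n - fps_nth 1 n" by (simp add: e_def)
      also have "\<dots> = ?s"
        by (subst 1) (simp only: V_def resolvent_series_def fps_nth_Abs_fps lessThan_Suc_atMost
            scaleC_add_left scaleC_minus_left diff_conv_add_uminus sum.distrib sum_negf)
      finally show ?thesis .
    qed
    then have "- fps_nth (e i) n \<in> cstar_gen (Y i)" by (simp only: cstar_gen_polynomial)
    moreover have "E (- fps_nth (e i) n) = 0"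
    proof -
      have "- fps_nth (e i) n = fps_nth (V i) n + - fps_nth 1 n" by (simp add: e_def)
      then show ?thesis
        by (simp only: state_add[OF E] state_minus[OF E] EV[OF that]) (simp add: state_one[OF E] state_zero[OF E])
    qed
    ultimately show ?thesis using that by (simp add: C_def)
  qed
  \<comment> \<open>The additive form of \<Phi> enters here: subtracting 1 makes pencils add
    up.\<close>
  have pencil_sum: "pencil \<Phi> (\<Sum>i\<in>I. Y i) = 1 + (\<Sum>i\<in>I. U i - 1)"
  proof (rule fps_ext)
    fix n
    show "fps_nth (pencil \<Phi> (\<Sum>i\<in>I. Y i)) n = fps_nth (1 + (\<Sum>i\<in>I. U i - 1)) n"
      by (cases n) (auto simp: pencil_def U_def scalar_fps_def \<Phi>_def fps_sum_nth scaleC_add_left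
          scaleC_sum_left sum_subtractf scaleC_one scaleC_zero_left
          scaleC_minus_left diff_conv_add_uminus sum.distrib sum_negf simp del: add_uminus_conv_diff sum_constant)
  qed
  have "1 = pencil \<Phi> (\<Sum>i\<in>I. Y i) * W"
    unfolding W_def using \<Phi>0 by (intro pencil_resolvent_series[symmetric]) simp
  also have "\<dots> = W - (\<Sum>i\<in>I. w i)"
    by (simp add: pencil_sum w_def distrib_right sum_distrib_right sum_negf)
  finally have W: "W = 1 + (\<Sum>i\<in>I. w i)" by (simp add: algebra_simps)
  \<comment> \<open>Multiplying \<open>w i\<close> on the left by \<open>V i = 1 - e i\<close> and
    using \<open>V i * U i = 1\<close> gives \<open>V i * w i = - e i * W\<close>, which is then
    solved for \<open>w i\<close>.\<close>
  have w: "w i = - e i * (1 + (\<Sum>j\<in>I - {i}. w j))" if "i \<in> I" for i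
  proof -
    have "V i * w i = - (V i * U i * W - V i * W)"
      by (simp add: w_def algebra_simps)
    also have "\<dots> = - e i * W" by (simp add: VU[OF that] e_def algebra_simps)
    finally have "w i = - e i * W + e i * w i" by (simp add: e_def algebra_simps)
    also have "\<dots> = - e i * (W - w i)" by (simp add: algebra_simps)
    also have "W - w i = 1 + (\<Sum>j\<in>I - {i}. w j)"
      unfolding W using I that by (simp add: sum.remove)
    finally show ?thesis .
  qed
  \<comment> \<open>As \<open>e i\<close> has no constant term, coefficient \<open>n\<close> of
    \<open>w i\<close> involves only lower coefficients of the \<open>w j\<close> with
    \<open>j \<noteq> i\<close>; induction on \<open>n\<close> unfolds the recursion.\<close>
  have alt: "alternating C i (fps_nth (w i) n)" if "i \<in> I" for i n
    using that
  proof (induction n arbitrary: i rule: less_induct)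
    case (less n)
    have "fps_nth (w i) n = (\<Sum>p=0..n. - fps_nth (e i) p * fps_nth (1 + (\<Sum>j\<in>I - {i}. w j)) (n - p))"
      by (subst w[OF less.prems]) (simp only: fps_mult_nth fps_neg_nth)
    also have "alternating C i \<dots>"
    proof (rule alternating_sum)
      fix p assume p: "p \<in> {0..n}"
      show "alternating C i (- fps_nth (e i) p * fps_nth (1 + (\<Sum>j\<in>I - {i}. w j)) (n - p))"
      proof (cases "p = 0")
        case True
        then show ?thesis using e0[OF less.prems] by (simp add: alternating.zero)
      next
        case False
        have "alternating C i (- fps_nth (e i) p * fps_nth (w j) (n - p))" if "j \<in> I - {i}" for j
          using that False p by (intro alternating.word[OF e_C[OF less.prems] less.IH]) auto
        then have "alternating C i (\<Sum>j\<in>I - {i}. - fps_nth (e i) p * fps_nth (w j) (n - p))"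
          by (rule alternating_sum)
        moreover have "alternating C i (- fps_nth (e i) p * fps_nth 1 (n - p))"
          using alternating.letter[of _ C, OF e_C[OF less.prems]] by (simp add: alternating.zero)
        ultimately have "alternating C i (- fps_nth (e i) p * fps_nth 1 (n - p) +
            (\<Sum>j\<in>I - {i}. - fps_nth (e i) p * fps_nth (w j) (n - p)))"
          by (rule alternating.add[rotated])
        then show ?thesis
          by (simp only: fps_add_nth fps_sum_nth distrib_left sum_distrib_left)
      qed
    qed
    finally show ?case .
  qed
  have "E (fps_nth W n) = fps_nth 1 n" for n
  proof -
    have "E (fps_nth (w i) n) = 0" if "i \<in> I" for i
      by (rule state_alternating[OF E free _ alt[OF that]]) (simp add: C_def)
    then show ?thesis
      unfolding W by (simp add: fps_sum_nth state_add[OF E] state_sum[OF E] state_one[OF E] state_zero[OF E])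
  qed
  then have "fps_compose (moment_series E (\<Sum>i\<in>I. Y i)) (fps_X * inverse \<Phi>) * inverse \<Phi> = 1"
    unfolding W_def state_resolvent_series[OF E] by (rule fps_ext)
  then have "fps_compose (moment_series E (\<Sum>i\<in>I. Y i)) (fps_X * inverse \<Phi>) * (inverse \<Phi> * \<Phi>) = \<Phi>"
    by (metis mult.assoc mult_1_left)
  moreover have "inverse \<Phi> * \<Phi> = 1" using \<Phi>0 by (intro inverse_mult_eq_1) simp
  ultimately show ?thesis by simp
qed

section \<open>Moment series of bounded distributions\<close>

lemma spectral_measure_AE_bounded:
  assumes "spectral_measure E A \<mu>" "norm A \<le> r"
  shows "AE t in \<mu>. \<bar>t\<bar> \<le> r"
proof (rule AE_I[where N = "- {- norm A .. norm A}"])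
  show "{t \<in> space \<mu>. \<not> \<bar>t\<bar> \<le> r} \<subseteq> - {- norm A .. norm A}" using assms(2) by auto
qed (use assms(1) in \<open>auto simp: spectral_measure_def\<close>)

text \<open>The map sends the unit disc into a half-plane; the inequality amounts to
  \<open>|1 - u|^2 \<le> 2 (1 - Re u)\<close>, that is, \<open>|u| \<le> 1\<close>.\<close>

lemma Re_inverse_one_minus_ge_half:
  assumes "cmod u < 1"
  shows "Re (1 / (1 - u)) \<ge> 1 / 2"
proof -
  have u: "(Re u)\<^sup>2 + (Im u)\<^sup>2 < 1"
    using assms by (simp add: cmod_def)
  have "Re u < 1" using assms complex_Re_le_cmod[of u] by linarith
  then have pos: "(1 - Re u)\<^sup>2 + (Im u)\<^sup>2 > 0" by (intro add_pos_nonneg) auto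
  have "(1 - Re u)\<^sup>2 + (Im u)\<^sup>2 \<le> 2 * (1 - Re u)"
    using u by (simp add: power2_eq_square algebra_simps)
  with pos show ?thesis by (simp add: Re_divide field_simps)
qed

context real_distribution
begin

text \<open>The sum is the integral of \<open>1 / (1 - t z)\<close>, by exchanging sum and integral
  under geometric domination; the pointwise lower bound on the real part survives averaging over a
  probability measure.\<close>

lemma moment_series_sums:
  assumes bd: "AE t in M. \<bar>t\<bar> \<le> r" and r: "r \<ge> 0" and z: "cmod z * r < 1"
  shows "\<exists>s. (\<lambda>j. complex_of_real (\<integral>t. t ^ j \<partial>M) * z ^ j) sums s \<and> Re s \<ge> 1 / 2"
proof -
  let ?f = "\<lambda>j t. (complex_of_real t * z) ^ j"
  have le: "AE t in M. cmod (?f j t) \<le> (cmod z * r) ^ j" for j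
    using bd by eventually_elim
      (auto simp: norm_power norm_mult mult.commute intro!: power_mono mult_right_mono)
  have int: "integrable M (?f j)" for j
    by (rule integrable_const_bound[OF le]) measurable
  have "norm (\<integral>t. cmod (?f j t) \<partial>M) \<le> (cmod z * r) ^ j" for j
    using integral_le_const[OF integrable_norm[OF int] le] by (simp add: integral_nonneg)
  then have sm: "summable (\<lambda>j. \<integral>t. cmod (?f j t) \<partial>M)"
    by (intro summable_comparison_test'[OF summable_geometric[of "cmod z * r"]]) (use z r in auto)
  have lt: "AE t in M. cmod (complex_of_real t * z) < 1"
    using le[of 1] by eventually_elim (use z in auto)
  then have ae: "AE t in M. summable (\<lambda>j. cmod (?f j t))"
    by eventually_elim (auto simp: norm_power intro!: summable_geometric)
  let ?s = "\<integral>t. (\<Sum>j. ?f j t) \<partial>M"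
  have "(\<lambda>j. \<integral>t. ?f j t \<partial>M) sums ?s"
    by (rule sums_integral[OF int ae sm])
  moreover have "(\<integral>t. ?f j t \<partial>M) = complex_of_real (\<integral>t. t ^ j \<partial>M) * z ^ j" for j
  proof -
    have "(\<integral>t. ?f j t \<partial>M) = (\<integral>t. complex_of_real (t ^ j) * z ^ j \<partial>M)"
      by (simp add: power_mult_distrib)
    then show ?thesis by (simp del: of_real_power)
  qed
  moreover have "Re ?s \<ge> 1 / 2"
  proof -
    have int_s: "integrable M (\<lambda>t. \<Sum>j. ?f j t)" by (rule integrable_suminf[OF int ae sm])
    have "AE t in M. 1 / 2 \<le> Re (\<Sum>j. ?f j t)"
      using lt by eventually_elim (use Re_inverse_one_minus_ge_half in \<open>simp add: suminf_geometric\<close>)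
    from integral_ge_const[OF _ this] show ?thesis using int_s by simp
  qed
  ultimately show ?thesis by auto
qed

text \<open>On the open disc of radius \<open>1 / r\<close> the moment series has modulus at least
  1/2, so the inverse power is at most \<open>2 ^ n\<close>; Cauchy's inequality then bounds its
  coefficients.\<close>

lemma norm_inverse_moment_series_power:
  assumes bd: "AE t in M. \<bar>t\<bar> \<le> r" and r: "r > 0"
  shows "cmod (fps_nth (inverse (Abs_fps (\<lambda>j. complex_of_real (\<integral>t. t ^ j \<partial>M))) ^ n) k) \<le> 2 ^ n * r ^ k"
proof -
  define F where "F = Abs_fps (\<lambda>j. complex_of_real (\<integral>t. t ^ j \<partial>M))"
  have F0: "fps_nth F 0 = 1" using prob_space by (simp add: F_def)
  have sums: "\<exists>s. (\<lambda>j. fps_nth F j * z ^ j) sums s \<and> Re s \<ge> 1 / 2" if "cmod z < 1 / r" for z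
    unfolding F_def fps_nth_Abs_fps using moment_series_sums[OF bd, of z] r that by (simp add: field_simps)
  have rad: "fps_conv_radius F \<ge> ereal (1 / r)"
    unfolding fps_conv_radius_def
  proof (rule conv_radius_geI_ex')
    fix \<rho> :: real assume "0 < \<rho>" "ereal \<rho> < ereal (1 / r)"
    then have "cmod (of_real \<rho>) < 1 / r" by simp
    from sums[OF this] show "summable (\<lambda>j. fps_nth F j * of_real \<rho> ^ j)"
      by (auto simp: sums_iff)
  qed
  have half: "cmod (eval_fps F z) \<ge> 1 / 2" if "cmod z < 1 / r" for z
  proof -
    have "Re (eval_fps F z) \<ge> 1 / 2"
      using sums[OF that] by (auto simp: eval_fps_def sums_iff)
    then show ?thesis using complex_Re_le_cmod[of "eval_fps F z"] by linarith
  qed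
  let ?h = "\<lambda>z. inverse (eval_fps F z) ^ n"
  have "fps_conv_radius F > 0"
    by (rule less_le_trans[OF _ rad]) (use r in simp)
  then have exp: "?h has_fps_expansion inverse F ^ n"
    using F0 by (intro has_fps_expansion_power has_fps_expansion_inverse eval_fps_has_fps_expansion) auto
  have hol: "?h holomorphic_on ball 0 (1 / r)"
  proof -
    have "ball 0 (1 / r) \<subseteq> eball (0::complex) (fps_conv_radius F)"
      using order.strict_trans2[OF _ rad] by (auto simp: in_eball_iff)
    moreover have "eval_fps F z \<noteq> 0" if "z \<in> ball 0 (1 / r)" for z
      using half[of z] that by auto
    ultimately show ?thesis by (intro holomorphic_intros) auto
  qed
  have bound: "cmod (fps_nth (inverse F ^ n) k) * \<rho> ^ k \<le> 2 ^ n" if \<rho>: "0 < \<rho>" "\<rho> < 1 / r" for \<rho>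
  proof -
    have "cmod ((deriv ^^ k) ?h 0) \<le> fact k * 2 ^ n / \<rho> ^ k"
    proof (rule Cauchy_inequality)
      show "?h holomorphic_on ball 0 \<rho>" by (rule holomorphic_on_subset[OF hol]) (use \<rho> in auto)
      show "continuous_on (cball 0 \<rho>) ?h"
        by (rule holomorphic_on_imp_continuous_on, rule holomorphic_on_subset[OF hol]) (use \<rho> in auto)
      fix z :: complex assume "cmod (0 - z) = \<rho>"
      then have "cmod (inverse (eval_fps F z)) \<le> 2"
        using half[of z] \<rho> le_imp_inverse_le[of "1 / 2" "cmod (eval_fps F z)"] by (simp add: norm_inverse)
      then show "cmod (?h z) \<le> 2 ^ n"
        unfolding norm_power by (intro power_mono) auto
    qed fact
    then show ?thesis
      using \<rho> by (simp add: fps_nth_fps_expansion[OF exp] norm_divide field_simps)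
  qed
  \<comment> \<open>The estimate holds only inside the open disc, so the radius \<rho> tends to
    \<open>1 / r\<close> from below.\<close>
  have "cmod (fps_nth (inverse F ^ n) k) * (1 / r) ^ k \<le> 2 ^ n"
  proof (rule tendsto_upperbound)
    show "((\<lambda>\<rho>. cmod (fps_nth (inverse F ^ n) k) * \<rho> ^ k) \<longlongrightarrow>
        cmod (fps_nth (inverse F ^ n) k) * (1 / r) ^ k) (at_left (1 / r))"
      by (intro tendsto_intros)
    have "\<forall>\<^sub>F \<rho> in at_left (1 / r). \<rho> \<in> {0<..<1 / r}"
      using r by (intro eventually_at_leftI[of 0]) auto
    then show "\<forall>\<^sub>F \<rho> in at_left (1 / r). cmod (fps_nth (inverse F ^ n) k) * \<rho> ^ k \<le> 2 ^ n"
      by eventually_elim (use bound in auto)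
  qed auto
  then show ?thesis using r by (simp add: F_def power_divide field_simps)
qed

text \<open>Mass near a point outside the interval would make the even moments grow like
  \<open>q ^ (2 * n)\<close> with \<open>q > r\<close>. The bound \<open>K\<close> secures
  integrability of the powers.\<close>

lemma measure_support_subset_moments:
  assumes bd: "AE t in M. \<bar>t\<bar> \<le> K" and r: "r \<ge> 0"
    and moments: "\<And>n. \<bar>\<integral>t. t ^ n \<partial>M\<bar> \<le> B * r ^ n"
  shows "measure_support M \<subseteq> {- r .. r}"
proof
  fix x assume x: "x \<in> measure_support M"
  show "x \<in> {- r .. r}"
  proof (rule ccontr)
    assume "x \<notin> {- r .. r}"
    then have xr: "\<bar>x\<bar> > r" by auto
    \<comment> \<open>Half the distance to the interval, so that \<open>q\<close> is the midpoint of
      \<open>r\<close> and \<open>|x|\<close>, and \<open>|t| \<ge> q\<close> on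
      \<open>?A\<close>.\<close>
    define e where "e = (\<bar>x\<bar> - r) / 2"
    define q where "q = \<bar>x\<bar> - e"
    have e: "e > 0" and q: "q > r" using xr by (auto simp: e_def q_def field_simps)
    let ?A = "{x - e <..< x + e}"
    have int: "integrable M (\<lambda>t. t ^ n)" for n
      by (rule integrable_const_bound[where B = "K ^ n"])
        (use bd in eventually_elim, auto simp: power_abs intro!: power_mono)
    have le: "measure M ?A * q ^ (2 * n) \<le> B * r ^ (2 * n)" for n
    proof -
      have "measure M ?A * q ^ (2 * n) = (\<integral>t. indicator ?A t * q ^ (2 * n) \<partial>M)"
        by simp
      also have "\<dots> \<le> (\<integral>t. t ^ (2 * n) \<partial>M)"
      proof (rule integral_mono)
        fix t
        show "indicator ?A t * q ^ (2 * n) \<le> t ^ (2 * n)"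
        proof (cases "t \<in> ?A")
          case True
          then have "q \<le> \<bar>t\<bar>" unfolding q_def by auto
          then have "q ^ (2 * n) \<le> \<bar>t\<bar> ^ (2 * n)" using q r by (intro power_mono) auto
          then show ?thesis using True by (simp add: power_even_abs)
        qed (simp add: zero_le_even_power)
      qed (auto intro!: int integrable_real_indicator simp: emeasure_eq_measure)
      finally show ?thesis using moments[of "2 * n"] by linarith
    qed
    have "measure M ?A \<le> B * (r / q) ^ (2 * n)" for n
      using le[of n] q r by (simp add: power_divide field_simps)
    then have "measure M ?A \<le> B * ((r / q)\<^sup>2) ^ n" for n
      by (simp only: power_mult)
    moreover have "(\<lambda>n. B * ((r / q)\<^sup>2) ^ n) \<longlonglongrightarrow> B * 0"
    proof (intro tendsto_mult tendsto_const LIMSEQ_power_zero)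
      have "r / q < 1" "r / q \<ge> 0" using q r by auto
      then show "norm ((r / q)\<^sup>2) < 1" by (simp add: abs_square_less_1)
    qed
    ultimately have "measure M ?A \<le> 0"
      by (intro tendsto_lowerbound[of _ "0::real"]) (auto intro!: always_eventually)
    then have "emeasure M ?A = 0" by (simp add: emeasure_eq_measure measure_le_0_iff)
    then show False using x e by (auto simp: measure_support_def)
  qed
qed

end

section \<open>Support of a free sum\<close>

lemma real_distribution_spectral_measure:
  "spectral_measure E A \<mu> \<Longrightarrow> real_distribution \<mu>"
  by (auto simp: spectral_measure_def real_distribution_def real_distribution_axioms_def)

lemma moment_series_spectral_measure:
  assumes "spectral_measure E A \<mu>"
  shows "moment_series E A = Abs_fps (\<lambda>j. complex_of_real (\<integral>t. t ^ j \<partial>\<mu>))"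
  using assms by (simp add: moment_series_def spectral_measure_def del: integral_complex_of_real)

lemma norm_free_cumulant:
  assumes E: "nc_prob_state E" and spec: "spectral_measure E A \<mu>" and R: "norm A \<le> R" "R > 0" and n: "n \<ge> 1"
  shows "cmod (fps_nth (cumulant_series (moment_series E A)) (Suc n)) \<le> 2 ^ n * R ^ Suc n / n"
proof -
  interpret real_distribution \<mu> using spec by (rule real_distribution_spectral_measure)
  have "fps_nth (moment_series E A) 0 = 1" by (simp add: moment_series_def state_one[OF E])
  then have "cmod (fps_nth (cumulant_series (moment_series E A)) (Suc n))
      = cmod (fps_nth (inverse (moment_series E A) ^ n) (Suc n)) / n"
    by (simp add: fps_nth_cumulant_series[OF _ n] norm_divide)
  also have "\<dots> \<le> 2 ^ n * R ^ Suc n / n"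
    unfolding moment_series_spectral_measure[OF spec]
    by (intro divide_right_mono norm_inverse_moment_series_power spectral_measure_AE_bounded[OF spec R(1)])
      (use R in auto)
  finally show ?thesis .
qed

text \<open>The radius \<open>r\<close> is \<open>B * sqrt v\<close>, with \<open>B\<close> bounding
  the absolute coefficient sum of \<Phi> on the circle of radius \<open>1 / sqrt v\<close>.\<close>

theorem free_sum_support:
  fixes Y :: "'i \<Rightarrow> 'a::cstar_algebra"
  assumes E: "nc_prob_state E" and I: "finite I" and free: "free_family E I Y"
    and centered: "\<And>i. i \<in> I \<Longrightarrow> E (Y i) = 0"
    and spec: "\<And>i. i \<in> I \<Longrightarrow> spectral_measure E (Y i) (\<mu> i)"
    and specS: "spectral_measure E (\<Sum>i\<in>I. Y i) \<nu>"
    and v: "complex_of_real v = (\<Sum>i\<in>I. E (Y i ^ 2))" "v > 0"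
    and R: "\<And>i. i \<in> I \<Longrightarrow> norm (Y i) \<le> R i" "\<And>i. i \<in> I \<Longrightarrow> R i > 0"
    and small: "\<And>i. i \<in> I \<Longrightarrow> 4 * R i \<le> sqrt v"
  defines "r \<equiv> 2 * sqrt v + 4 * (\<Sum>i\<in>I. R i ^ 3) / v"
  shows "measure_support \<nu> \<subseteq> {- r .. r}"
proof -
  define \<phi> where "\<phi> i = cumulant_series (moment_series E (Y i))" for i
  define \<Phi> where "\<Phi> = 1 + (\<Sum>i\<in>I. \<phi> i - 1)"
  \<comment> \<open>This radius minimises \<open>(1 + v * \<rho>^2) / \<rho>\<close>, with minimum
    \<open>2 * sqrt v\<close>: the leading term of \<open>r\<close>.\<close>
  define \<rho> where "\<rho> = 1 / sqrt v"
  define c where "c = 2 * (\<Sum>i\<in>I. (R i * \<rho>) ^ 3)"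
  \<comment> \<open>The 2 comes from degrees 0 and 2, contributing 1 each; \<open>2 * c\<close> is
    the geometric sum of the tail from degree 3 on.\<close>
  define B where "B = 2 + 2 * c"
  have \<rho>: "\<rho> > 0" using v by (simp add: \<rho>_def)
  have c: "c \<ge> 0" unfolding c_def using R(2) \<rho> by (intro mult_nonneg_nonneg sum_nonneg) (auto intro: less_imp_le)
  have M0: "fps_nth (moment_series E x) 0 = 1" for x
    by (simp add: moment_series_def state_one[OF E])
  have M1: "fps_nth (moment_series E (Y i)) 1 = 0" if "i \<in> I" for i
    using centered[OF that] by (simp add: moment_series_def)
  have \<phi>_eqs: "fps_nth (\<phi> i) 0 = 1"
    "fps_compose (moment_series E (Y i)) (fps_X * inverse (\<phi> i)) = \<phi> i" for i
    unfolding \<phi>_def by (rule cumulant_series_equations[OF M0])+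
  have \<Phi>_nth: "fps_nth \<Phi> (Suc n) = (\<Sum>i\<in>I. fps_nth (\<phi> i) (Suc n))" for n
    by (simp add: \<Phi>_def fps_sum_nth)
  have \<Phi>0: "fps_nth \<Phi> 0 = 1"
    by (simp add: \<Phi>_def fps_sum_nth \<phi>_eqs(1))
  have \<Phi>1: "fps_nth \<Phi> 1 = 0"
    using \<Phi>_nth[of 0] cumulant_series_centered(1)[OF M0 M1] by (simp add: \<phi>_def)
  have \<Phi>2: "fps_nth \<Phi> 2 = complex_of_real v"
    using \<Phi>_nth[of 1] cumulant_series_centered(2)[OF M0 M1]
    by (simp add: \<phi>_def v(1) moment_series_def numeral_2_eq_2)
  have tail: "cmod (fps_nth \<Phi> (l + 3)) * \<rho> ^ (l + 3) \<le> c * (1 / 2) ^ l" for l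
  proof -
    have "cmod (fps_nth \<Phi> (l + 3)) \<le> (\<Sum>i\<in>I. cmod (fps_nth (\<phi> i) (l + 3)))"
      using \<Phi>_nth[of "l + 2"] norm_sum[of "\<lambda>i. fps_nth (\<phi> i) (l + 3)" I]
      by (simp add: numeral_2_eq_2 numeral_3_eq_3)
    then have "cmod (fps_nth \<Phi> (l + 3)) * \<rho> ^ (l + 3) \<le> (\<Sum>i\<in>I. cmod (fps_nth (\<phi> i) (l + 3)) * \<rho> ^ (l + 3))"
      unfolding sum_distrib_right[symmetric] using \<rho> by (intro mult_right_mono) auto
    also have "\<dots> \<le> (\<Sum>i\<in>I. 2 * (R i * \<rho>) ^ 3 * (1 / 2) ^ l)"
    proof (rule sum_mono)
      fix i assume i: "i \<in> I"
      \<comment> \<open>The bound 1/4 makes \<open>2 * (R i * \<rho>)\<close> at most 1/2, the ratio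
        of the geometric tail.\<close>
      have u: "0 \<le> R i * \<rho>" "R i * \<rho> \<le> 1 / 4"
        using R(2)[OF i] small[OF i] v(2) by (auto simp: \<rho>_def field_simps)
      have "cmod (fps_nth (\<phi> i) (l + 3)) \<le> 2 ^ (l + 2) * R i ^ (l + 3) / real (l + 2)"
        using norm_free_cumulant[OF E spec[OF i] R(1)[OF i] R(2)[OF i], of "l + 2"]
        by (simp add: \<phi>_def numeral_2_eq_2 numeral_3_eq_3)
      also have "\<dots> \<le> 2 ^ (l + 2) * R i ^ (l + 3) / 2"
        using R(2)[OF i] by (intro divide_left_mono) auto
      finally have "cmod (fps_nth (\<phi> i) (l + 3)) * \<rho> ^ (l + 3) \<le> 2 ^ (l + 2) * R i ^ (l + 3) / 2 * \<rho> ^ (l + 3)"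
        using \<rho> by (intro mult_right_mono) auto
      also have "\<dots> = 2 * (R i * \<rho>) ^ 3 * (2 * (R i * \<rho>)) ^ l"
        by (simp add: power_add power_mult_distrib)
      also have "\<dots> \<le> 2 * (R i * \<rho>) ^ 3 * (1 / 2) ^ l"
        using u by (intro mult_left_mono power_mono) auto
      finally show "cmod (fps_nth (\<phi> i) (l + 3)) * \<rho> ^ (l + 3) \<le> 2 * (R i * \<rho>) ^ 3 * (1 / 2) ^ l" .
    qed
    also have "\<dots> = c * (1 / 2) ^ l" by (simp add: c_def sum_distrib_left sum_distrib_right)
    finally show ?thesis .
  qed
  have majorant: "(\<Sum>j\<le>N. cmod (fps_nth \<Phi> j) * \<rho> ^ j) \<le> B" for N
  proof -
    let ?t = "\<lambda>j. cmod (fps_nth \<Phi> j) * \<rho> ^ j"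
    \<comment> \<open>The range is extended so that three initial terms can be split off for every
      \<open>N\<close>.\<close>
    have "(\<Sum>j\<le>N. ?t j) \<le> (\<Sum>j<N + 3. ?t j)"
      using \<rho> by (intro sum_mono2) auto
    also have "\<dots> = ?t 0 + ?t 1 + ?t 2 + (\<Sum>l<N. ?t (l + 3))"
      by (simp add: numeral_3_eq_3 numeral_2_eq_2 sum.lessThan_Suc_shift del: sum.lessThan_Suc power_Suc)
    also have "?t 2 = 1" using v(2) by (simp add: \<Phi>2 \<rho>_def power_divide)
    also have "(\<Sum>l<N. ?t (l + 3)) \<le> (\<Sum>l<N. c * (1 / 2) ^ l)"
      by (rule sum_mono) (rule tail)
    also have "\<dots> = c * (\<Sum>l<N. (1 / 2) ^ l)" by (simp add: sum_distrib_left)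
    also have "\<dots> \<le> c * 2"
      using c by (intro mult_left_mono) (simp_all add: sum_gp_strict)
    finally show ?thesis using \<Phi>1 by (simp add: \<Phi>0 B_def)
  qed
  have B: "B \<ge> 0" using c by (simp add: B_def)
  have rB: "r = B / \<rho>"
  proof -
    have "(\<Sum>i\<in>I. (R i * \<rho>) ^ 3) / \<rho> = (\<Sum>i\<in>I. R i ^ 3) * \<rho>\<^sup>2"
      using \<rho> by (simp add: power_mult_distrib flip: sum_distrib_right) (simp add: power2_eq_square power3_eq_cube)
    also have "\<rho>\<^sup>2 = 1 / v" using v by (simp add: \<rho>_def power_divide)
    finally have "c / \<rho> = 2 * (\<Sum>i\<in>I. R i ^ 3) / v" unfolding c_def by simp
    moreover have "2 / \<rho> = 2 * sqrt v" by (simp add: \<rho>_def)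
    ultimately show ?thesis unfolding B_def r_def by (simp add: add_divide_distrib)
  qed
  \<comment> \<open>The exponent \<open>Suc n\<close> of \<Phi> yields
    \<open>B ^ Suc n / \<rho> ^ n = B * r ^ n\<close>; the gain \<open>1 / (n + 1)\<close> is
    discarded.\<close>
  have moments: "\<bar>\<integral>t. t ^ n \<partial>\<nu>\<bar> \<le> B * r ^ n" for n
  proof -
    let ?M = "moment_series E (\<Sum>i\<in>I. Y i)"
    have "fps_compose ?M (fps_X * inverse \<Phi>) = \<Phi>"
      unfolding \<Phi>_def using free_cumulant_additivity[OF E I free \<phi>_eqs(1,2)] .
    from fps_nth_power_of_cumulant_series[OF \<Phi>0 this, of n]
    have "real (Suc n) * cmod (fps_nth ?M n) = cmod (fps_nth (\<Phi> ^ Suc n) n)"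
      by (simp add: norm_mult del: power_Suc of_nat_Suc)
    moreover have "1 * cmod (fps_nth ?M n) \<le> real (Suc n) * cmod (fps_nth ?M n)"
      by (intro mult_right_mono) auto
    ultimately have "cmod (fps_nth ?M n) \<le> cmod (fps_nth (\<Phi> ^ Suc n) n)" by simp
    moreover have "cmod (fps_nth (\<Phi> ^ Suc n) n) * \<rho> ^ n \<le> B ^ Suc n"
      using \<rho> by (intro order_trans[OF member_le_sum[of n "{..n}" "\<lambda>j. cmod (fps_nth (\<Phi> ^ Suc n) j) * \<rho> ^ j"]
            fps_power_majorant[OF _ majorant]]) auto
    moreover have "cmod (fps_nth ?M n) = \<bar>\<integral>t. t ^ n \<partial>\<nu>\<bar>"
      by (simp add: moment_series_spectral_measure[OF specS])
    ultimately have "\<bar>\<integral>t. t ^ n \<partial>\<nu>\<bar> * \<rho> ^ n \<le> B ^ Suc n"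
      using \<rho> by (smt (verit, best) mult_right_mono zero_le_power)
    then show ?thesis using \<rho> by (simp add: rB power_divide field_simps)
  qed
  interpret real_distribution \<nu> using specS by (rule real_distribution_spectral_measure)
  show ?thesis
    by (rule measure_support_subset_moments[OF spectral_measure_AE_bounded[OF specS order_refl] _ moments])
      (use B \<rho> in \<open>simp add: rB\<close>)
qed

text \<open>The point \<open>\<i> * R\<close> has distance at least \<open>R\<close> from every real
  \<open>t\<close>. Against the lower bound on \<open>|z| = R\<close>, this yields
  \<open>R \<le> 1 / m\<close>.\<close>

lemma norm_cauchy_transform_imaginary:
  assumes "prob_space \<mu>" and "R > 0"
  shows "cmod (cauchy_transform \<mu> (\<i> * complex_of_real R)) \<le> 1 / R"
proof -
  interpret prob_space \<mu> by fact
  let ?f = "\<lambda>t. 1 / (\<i> * complex_of_real R - complex_of_real t)"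
  have le: "cmod (?f t) \<le> 1 / R" for t
  proof -
    have "R \<le> cmod (\<i> * complex_of_real R - complex_of_real t)"
      using abs_Im_le_cmod[of "\<i> * complex_of_real R - complex_of_real t"] \<open>R > 0\<close> by simp
    then show ?thesis using \<open>R > 0\<close> by (simp add: norm_divide frac_le)
  qed
  show ?thesis
  proof (cases "integrable \<mu> ?f")
    case True
    have "cmod (integral\<^sup>L \<mu> ?f) \<le> (\<integral>t. cmod (?f t) \<partial>\<mu>)" by (rule integral_norm_bound)
    also have "\<dots> \<le> 1 / R" using True le by (intro integral_le_const) auto
    finally show ?thesis by (simp add: cauchy_transform_def)
  next
    \<comment> \<open>A non-integrable function has integral 0 by convention.\<close>
    case False
    then show ?thesis using \<open>R > 0\<close> by (simp add: cauchy_transform_def not_integrable_integral_eq)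
  qed
qed

text \<open>Relies on \<open>1 / 0 = 0\<close>; it excludes \<open>R = 0\<close> in the main theorem.\<close>

lemma cauchy_transform_point_mass_at_zero:
  assumes "AE t in \<mu>. \<bar>t\<bar> \<le> 0"
  shows "cauchy_transform \<mu> 0 = 0"
  unfolding cauchy_transform_def
  by (rule integral_eq_zero_AE) (use assms in eventually_elim, simp)

theorem theorem2:
  fixes E :: "'a::cstar_algebra \<Rightarrow> complex"
    and X :: "nat \<Rightarrow> nat \<Rightarrow> 'a"
    and k :: "nat \<Rightarrow> nat"
    and L R m :: "nat \<Rightarrow> nat \<Rightarrow> real"
    and \<mu> :: "nat \<Rightarrow> nat \<Rightarrow> real measure"
    and \<mu>S :: "nat \<Rightarrow> real measure"
    and v mn D :: "nat \<Rightarrow> real"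
  assumes state: "nc_prob_state E"
    and k_pos: "\<And>n. n \<ge> 1 \<Longrightarrow> k n \<ge> 1"
    and sa: "\<And>n i. n \<ge> 1 \<Longrightarrow> i \<in> {1..k n} \<Longrightarrow> self_adjoint (X n i)"
    and free: "\<And>n. n \<ge> 1 \<Longrightarrow> free_family E {1..k n} (X n)"
    and centered: "\<And>n i. n \<ge> 1 \<Longrightarrow> i \<in> {1..k n} \<Longrightarrow> E (X n i) = 0"
    and normL: "\<And>n i. n \<ge> 1 \<Longrightarrow> i \<in> {1..k n} \<Longrightarrow> norm (X n i) \<le> L n i"
    and spec: "\<And>n i. n \<ge> 1 \<Longrightarrow> i \<in> {1..k n} \<Longrightarrow> spectral_measure E (X n i) (\<mu> n i)"
    and v_def: "\<And>n. n \<ge> 1 \<Longrightarrow> complex_of_real (v n) = (\<Sum>i\<in>{1..k n}. E (X n i ^ 2))"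
    and specS: "\<And>n. n \<ge> 1 \<Longrightarrow> spectral_measure E (\<Sum>i\<in>{1..k n}. X n i) (\<mu>S n)"
    and R_ge: "\<And>n i. n \<ge> 1 \<Longrightarrow> i \<in> {1..k n} \<Longrightarrow> R n i \<ge> L n i"
    and m_pos: "\<And>n i. n \<ge> 1 \<Longrightarrow> i \<in> {1..k n} \<Longrightarrow> m n i > 0"
    and G_bound: "\<And>n i z. n \<ge> 1 \<Longrightarrow> i \<in> {1..k n} \<Longrightarrow> cmod z = R n i \<Longrightarrow>
                    cmod (cauchy_transform (\<mu> n i) z) \<ge> m n i"
    and g_zero: "\<And>n i. n \<ge> 1 \<Longrightarrow> i \<in> {1..k n} \<Longrightarrow>
                    (\<exists>!z. cmod z < inverse (R n i) \<and> inv_cauchy_transform (\<mu> n i) z = 0)"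
    and mn_def: "\<And>n. mn n = Min ((m n) ` {1..k n})"
    and D_def: "\<And>n. D n = (\<Sum>i\<in>{1..k n}. R n i / (m n i) ^ 2)"
    and lim_i: "liminf (\<lambda>n. ereal (mn n * sqrt (v n))) > 4"
    and lim_ii: "limsup (\<lambda>n. ereal (D n / v n powr (3/2))) \<le> 1/8"
  shows "\<forall>\<^sub>F n in sequentially.
           measure_support (\<mu>S n) \<subseteq>
             {- 2 * sqrt (v n) - 5 * D n / v n <..< 2 * sqrt (v n) + 5 * D n / v n}"
proof -
  have "\<forall>\<^sub>F n in sequentially. 4 < ereal (mn n * sqrt (v n))"
    using lim_i by (rule less_LiminfD)
  then show ?thesis using eventually_ge_at_top[of 1]
  proof eventually_elim
    case (elim n)
    let ?I = "{1..k n}"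
    have gap: "4 < mn n * sqrt (v n)" and n: "n \<ge> 1"
      using elim by simp_all
    have mn: "mn n \<le> m n i" if "i \<in> ?I" for i
      unfolding mn_def using that by (intro Min_le) auto
    have "mn n > 0"
      unfolding mn_def using k_pos[OF n] m_pos[OF n] by (subst Min_gr_iff) auto
    \<comment> \<open>With \<open>mn n > 0\<close>, a product above 4 forces a positive root; as
      \<open>sqrt\<close> is negative on negative numbers, \<open>v n > 0\<close> follows as
      well.\<close>
    then have sv: "sqrt (v n) > 0"
      using gap by (smt (verit) mult_nonneg_nonpos)
    then have v: "v n > 0" by simp
    have norm_R: "norm (X n i) \<le> R n i" if "i \<in> ?I" for i
      using normL[OF n that] R_ge[OF n that] by linarith
    have R: "R n i > 0" if "i \<in> ?I" for i
    proof (rule ccontr)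
      assume "\<not> R n i > 0"
      then have "R n i = 0" using norm_R[OF that] norm_ge_zero[of "X n i"] by linarith
      then show False
        using G_bound[OF n that, of 0] m_pos[OF n that] norm_R[OF that]
          cauchy_transform_point_mass_at_zero[OF spectral_measure_AE_bounded[OF spec[OF n that]]]
        by simp
    qed
    have Rm: "R n i \<le> 1 / m n i" if "i \<in> ?I" for i
    proof -
      have "prob_space (\<mu> n i)" using spec[OF n that] by (simp add: spectral_measure_def)
      then have "m n i \<le> 1 / R n i"
        using G_bound[OF n that, of "\<i> * complex_of_real (R n i)"] R[OF that]
          norm_cauchy_transform_imaginary[of "\<mu> n i" "R n i"]
        by (simp add: norm_mult)
      then show ?thesis using R[OF that] m_pos[OF n that] by (simp add: field_simps)
    qed
    have small: "4 * R n i \<le> sqrt (v n)" if "i \<in> ?I" for i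
    proof -
      have "4 < m n i * sqrt (v n)"
        using gap mult_right_mono[OF mn[OF that], of "sqrt (v n)"] sv by linarith
      then have "4 * (1 / m n i) \<le> sqrt (v n)" using m_pos[OF n that] by (simp add: field_simps)
      then show ?thesis using Rm[OF that] by linarith
    qed
    \<comment> \<open>Two of the three factors \<open>R n i\<close> are replaced by
      \<open>1 / m n i\<close>.\<close>
    have "(\<Sum>i\<in>?I. R n i ^ 3) \<le> D n"
      unfolding D_def
    proof (rule sum_mono)
      fix i assume i: "i \<in> ?I"
      have "R n i * R n i ^ 2 \<le> R n i * (1 / m n i) ^ 2"
        using Rm[OF i] R[OF i] by (intro mult_left_mono power_mono) auto
      then show "R n i ^ 3 \<le> R n i / (m n i) ^ 2"
        by (simp add: power_divide power3_eq_cube power2_eq_square)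
    qed
    then have "4 * (\<Sum>i\<in>?I. R n i ^ 3) / v n \<le> 4 * D n / v n"
      using v by (intro divide_right_mono) auto
    \<comment> \<open>Strict positivity makes the step from constant 4 to 5 strict, which places the
      closed interval inside the open one.\<close>
    moreover have "D n > 0"
      unfolding D_def using k_pos[OF n] R m_pos[OF n] by (intro sum_pos divide_pos_pos zero_less_power) auto
    then have "4 * D n / v n < 5 * D n / v n"
      using v by (intro divide_strict_right_mono) auto
    moreover have "measure_support (\<mu>S n) \<subseteq> {- (2 * sqrt (v n) + 4 * (\<Sum>i\<in>?I. R n i ^ 3) / v n) ..
        2 * sqrt (v n) + 4 * (\<Sum>i\<in>?I. R n i ^ 3) / v n}"
      by (rule free_sum_support[OF state _ free[OF n] centered[OF n] spec[OF n] specS[OF n] v_def[OF n] v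
            norm_R R small]) auto
    ultimately show ?case by fastforce
  qed
qed

end
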